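(* Let $R$ be a finite Frobenius ring and $w$ a homogeneous weight on $R$ with average value $\gamma>0$, extended additively to $R^n$. Let $C\leq {}_RR^n$ be a nonzero linear code of length $n$ and minimum homogeneous weight $d$ with $\gamma n\leq d$, and whose minimum Hamming weight is less than $n$. Let $P:=\max\{|Rc| : c\in C,\ \ell(c)<n\}$. Then $$n-\left\lceil \frac{P-1}{P}\,\frac{d}{\gamma}\right\rceil \;\geq\; \left\lceil \log_P|C|-\log_P|R|\right\rceil.$$
   Context: A finite ring $R$ (with identity) is Frobenius if the character group of $(R,+)$ is isomorphic to $R$ as a left $R$-module (equivalently, $R$ has a character whose kernel contains no nonzero left or right ideal). A function $w:R\to\mathbb{R}$ is a homogeneous weight with average value $\gamma$ if $w(0)=0$, $w(x)=w(y)$ whenever $Rx=Ry$, and $\sum_{y\in Rx} w(y)=\gamma|Rx|$ for all nonzero $x\in R$; on $R^n$, $w(c)=\sum_i w(c_i)$. Minimum homogeneous (resp. Hamming) weight of a code is the minimum of $w$ (resp. of the number of nonzero coordinates) over its nonzero words. $\ell(c)$ denotes the Hamming weight (number of nonzero coordinates) of $c$. *)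

theory Defs
  imports "HOL-Analysis.Analysis"
begin

text \<open>
  A finite ring with identity, not necessarily commutative, is a type of class ring_1 and finite.
  The class entails 0 \<noteq> 1; over the zero ring there is no nonzero code.
  The module \<open>R\<^sup>n\<close> is \<open>'a ^ 'n\<close> with \<open>n = CARD('n)\<close>, the left action being \<open>(*s)\<close>.
\<close>

text \<open>Characters of \<open>(R, +)\<close>: homomorphisms into the multiplicative group of nonzero complex
  numbers. For finite \<open>R\<close> their values are roots of unity.\<close>

definition add_characters :: "('a::ab_group_add \<Rightarrow> complex) set" where
  "add_characters = {\<psi>. (\<forall>x. \<psi> x \<noteq> 0) \<and> (\<forall>x y. \<psi> (x + y) = \<psi> x * \<psi> y)}"

definition char_mult :: "('a \<Rightarrow> complex) \<Rightarrow> ('a \<Rightarrow> complex) \<Rightarrow> 'a \<Rightarrow> complex" where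
  "char_mult \<psi> \<xi> = (\<lambda>x. \<psi> x * \<xi> x)"

text \<open>The argument is multiplied on the right: this is what makes it a left action.\<close>

definition char_act :: "'a::ring_1 \<Rightarrow> ('a \<Rightarrow> complex) \<Rightarrow> 'a \<Rightarrow> complex" where
  "char_act r \<psi> = (\<lambda>x. \<psi> (x * r))"

definition frobenius_ring :: "'a::{ring_1,finite} itself \<Rightarrow> bool" where
  "frobenius_ring _ \<longleftrightarrow>
     (\<exists>\<phi> :: 'a \<Rightarrow> 'a \<Rightarrow> complex.
        bij_betw \<phi> UNIV add_characters \<and>
        (\<forall>a b. \<phi> (a + b) = char_mult (\<phi> a) (\<phi> b)) \<and>
        (\<forall>r a. \<phi> (r * a) = char_act r (\<phi> a)))"

definition left_principal_ideal :: "'a::ring_1 \<Rightarrow> 'a set" where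
  "left_principal_ideal x = range (\<lambda>r. r * x)"

definition homogeneous_weight :: "('a::{ring_1,finite} \<Rightarrow> real) \<Rightarrow> real \<Rightarrow> bool" where
  "homogeneous_weight w \<gamma> \<longleftrightarrow>
     w 0 = 0 \<and>
     (\<forall>x y. left_principal_ideal x = left_principal_ideal y \<longrightarrow> w x = w y) \<and>
     (\<forall>x. x \<noteq> 0 \<longrightarrow>
        (\<Sum>y\<in>left_principal_ideal x. w y) = \<gamma> * real (card (left_principal_ideal x)))"

definition left_linear_code :: "('a::ring_1 ^ 'n) set \<Rightarrow> bool" where
  "left_linear_code C \<longleftrightarrow>
     0 \<in> C \<and> (\<forall>x\<in>C. \<forall>y\<in>C. x + y \<in> C) \<and> (\<forall>r. \<forall>x\<in>C. r *s x \<in> C)"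

definition cyclic_submodule :: "'a::ring_1 ^ 'n \<Rightarrow> ('a ^ 'n) set" where
  "cyclic_submodule c = range (\<lambda>r. r *s c)"

definition vec_weight :: "('a \<Rightarrow> real) \<Rightarrow> 'a ^ 'n::finite \<Rightarrow> real" where
  "vec_weight w c = (\<Sum>i\<in>UNIV. w (c $ i))"

definition hamming_weight :: "'a::zero ^ 'n::finite \<Rightarrow> nat" where
  "hamming_weight c = card {i. c $ i \<noteq> 0}"

definition min_vec_weight ::
    "('a::{zero,finite} \<Rightarrow> real) \<Rightarrow> ('a ^ 'n::finite) set \<Rightarrow> real" where
  "min_vec_weight w C = Min (vec_weight w ` (C - {0}))"

definition min_hamming_weight :: "('a::{zero,finite} ^ 'n::finite) set \<Rightarrow> nat" where
  "min_hamming_weight C = Min (hamming_weight ` (C - {0}))"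

end

theory Submission
  imports Defs
begin

text \<open>
  Over a Frobenius ring a homogeneous weight has average \<open>\<gamma>\<close> on every nonzero left ideal, not
  only on the principal ones: if \<open>\<psi>\<close> is a generating character, then \<open>\<gamma> - w\<close> and
  \<open>\<gamma> Re \<psi>\<close> have the same sum over every principal left ideal, hence over every union of
  principal left ideals. Let \<open>c\<close> attain the maximum \<open>P\<close>, let \<open>i\<close> be a coordinate with
  \<open>c\<^sub>i = 0\<close>, and let \<open>M\<close> be the size of the subcode of the words vanishing at \<open>i\<close>. Then
  \<open>|C| \<le> |R| M\<close>, and \<open>M = k P\<close> for some \<open>k\<close> by Lagrange's theorem. Averaging the weight over
  this subcode yields \<open>(M - 1) d \<le> \<gamma> M (n - 1)\<close>, which together with \<open>\<gamma> n \<le> d\<close> gives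
  \<open>M \<le> n\<close> and \<open>(P - 1) / P * d / \<gamma> \<le> n - k\<close>. The bound follows from \<open>k P \<le> P\<^sup>k\<close>.
\<close>

section \<open>Additive subgroups: fibres, cosets and character sums\<close>

definition additive_subgroup :: "'a::ab_group_add set \<Rightarrow> bool" where
  "additive_subgroup H \<longleftrightarrow> 0 \<in> H \<and> (\<forall>x\<in>H. \<forall>y\<in>H. x - y \<in> H)"

lemma additive_subgroup_zero: "additive_subgroup H \<Longrightarrow> 0 \<in> H"
  by (simp add: additive_subgroup_def)

lemma additive_subgroup_diff: "additive_subgroup H \<Longrightarrow> x \<in> H \<Longrightarrow> y \<in> H \<Longrightarrow> x - y \<in> H"
  by (simp add: additive_subgroup_def)

lemma additive_subgroup_add:
  assumes "additive_subgroup H" "x \<in> H" "y \<in> H"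
  shows "x + y \<in> H"
proof -
  have "x - (0 - y) \<in> H"
    using assms unfolding additive_subgroup_def by blast
  then show ?thesis by simp
qed

text \<open>The fibres of \<open>f\<close> on \<open>H\<close> are translates of the kernel, so
  every value is taken equally often. This turns a sum over codewords into one over the values of a
  coordinate.\<close>

lemma sum_over_additive_image:
  fixes f :: "'a::ab_group_add \<Rightarrow> 'b::ab_group_add" and g :: "'b \<Rightarrow> real"
  assumes H: "additive_subgroup H" and fin: "finite H"
    and add: "\<And>x y. f (x - y) = f x - f y"
  shows "(\<Sum>x\<in>H. g (f x)) = real (card {x \<in> H. f x = 0}) * (\<Sum>y\<in>f ` H. g y)"
proof -
  have fibre: "card {x \<in> H. f x = y} = card {x \<in> H. f x = 0}" if "y \<in> f ` H" for y
  proof -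
    obtain z where z: "z \<in> H" "y = f z" using \<open>y \<in> f ` H\<close> by blast
    have "bij_betw (\<lambda>x. x - z) {x \<in> H. f x = y} {x \<in> H. f x = 0}"
    proof (rule bij_betw_byWitness[where f' = "\<lambda>x. x + z"])
      have "f (x + z) = f z" if "f x = 0" for x
        using add[of "x + z" z] that by simp
      then show "(\<lambda>x. x + z) ` {x \<in> H. f x = 0} \<subseteq> {x \<in> H. f x = y}"
        using z additive_subgroup_add[OF H] by auto
    qed (use z add additive_subgroup_diff[OF H] in auto)
    then show ?thesis by (rule bij_betw_same_card)
  qed
  have "(\<Sum>x\<in>H. g (f x)) = (\<Sum>y\<in>f ` H. \<Sum>x\<in>{x \<in> H. f x = y}. g (f x))"
    by (rule sum.image_gen[OF fin])
  also have "\<dots> = (\<Sum>y\<in>f ` H. real (card {x \<in> H. f x = 0}) * g y)"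
    by (intro sum.cong refl) (simp add: fibre)
  finally show ?thesis by (simp add: sum_distrib_left)
qed

lemma card_additive_image:
  fixes f :: "'a::ab_group_add \<Rightarrow> 'b::ab_group_add"
  assumes "additive_subgroup H" "finite H" "\<And>x y. f (x - y) = f x - f y"
  shows "card H = card {x \<in> H. f x = 0} * card (f ` H)"
proof -
  have "real (card H) = real (card {x \<in> H. f x = 0} * card (f ` H))"
    using sum_over_additive_image[OF assms, of "\<lambda>_. 1"] by simp
  then show ?thesis by (simp only: of_nat_eq_iff)
qed

text \<open>Lagrange's theorem: the cosets of \<open>K\<close> partition \<open>H\<close> into
  blocks of size \<open>card K\<close>.\<close>

lemma additive_subgroup_card_dvd:
  fixes H K :: "'a::ab_group_add set"
  assumes H: "additive_subgroup H" and K: "additive_subgroup K"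
    and sub: "K \<subseteq> H" and fin: "finite H"
  shows "card K dvd card H"
proof -
  let ?coset = "\<lambda>x. (+) x ` K"
  have un: "\<Union> (?coset ` H) = H"
  proof
    show "\<Union> (?coset ` H) \<subseteq> H" using sub additive_subgroup_add[OF H] by auto
    show "H \<subseteq> \<Union> (?coset ` H)"
    proof
      fix x assume "x \<in> H"
      moreover have "x \<in> ?coset x"
        using additive_subgroup_zero[OF K] by (intro image_eqI[of _ _ 0]) auto
      ultimately show "x \<in> \<Union> (?coset ` H)" by blast
    qed
  qed
  \<comment> \<open>One inclusion suffices: exchanging \<open>x\<close> and \<open>y\<close> gives
    the other, so cosets that meet coincide.\<close>
  have coset_le: "?coset x \<subseteq> ?coset y" if z: "z \<in> ?coset x" "z \<in> ?coset y" for x y z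
  proof
    fix t assume "t \<in> ?coset x"
    then obtain a b c where abc: "a \<in> K" "b \<in> K" "c \<in> K" "t = x + a" "z = x + b" "z = y + c"
      using z by blast
    then have "x = y + c - b" by (simp add: algebra_simps)
    then have "t = y + (c - b + a)" using abc(4) by (simp add: algebra_simps)
    moreover have "c - b + a \<in> K"
      using abc additive_subgroup_diff[OF K] additive_subgroup_add[OF K] by blast
    ultimately show "t \<in> ?coset y" by blast
  qed
  have "card K dvd card (\<Union> (?coset ` H))"
  proof (rule dvd_partition)
    show "finite (\<Union> (?coset ` H))" by (simp add: un fin)
    show "\<forall>c\<in>?coset ` H. card K dvd card c" by (auto simp: card_image)
    show "\<forall>c1\<in>?coset ` H. \<forall>c2\<in>?coset ` H. c1 \<noteq> c2 \<longrightarrow> c1 \<inter> c2 = {}"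
      using coset_le by blast
  qed
  then show ?thesis by (simp add: un)
qed

text \<open>Translation by \<open>z\<close> permutes \<open>H\<close> and multiplies the sum by
  \<open>\<psi> z\<close>.\<close>

lemma sum_character_eq_0:
  fixes \<psi> :: "'a::ab_group_add \<Rightarrow> complex"
  assumes "additive_subgroup H" and \<psi>: "\<psi> \<in> add_characters"
    and "z \<in> H" and "\<psi> z \<noteq> 1"
  shows "sum \<psi> H = 0"
proof -
  have "sum \<psi> H = (\<Sum>x\<in>H. \<psi> (x + z))"
    by (rule sum.reindex_bij_witness[of _ "\<lambda>x. x + z" "\<lambda>x. x - z"])
       (use assms additive_subgroup_add additive_subgroup_diff in auto)
  also have "\<dots> = sum \<psi> H * \<psi> z"
    using \<psi> by (simp add: add_characters_def sum_distrib_right)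
  finally show ?thesis using \<open>\<psi> z \<noteq> 1\<close> by simp
qed

section \<open>Left ideals and generating characters\<close>

definition left_ideal :: "'a::ring_1 set \<Rightarrow> bool" where
  "left_ideal I \<longleftrightarrow> additive_subgroup I \<and> (\<forall>r. \<forall>x\<in>I. r * x \<in> I)"

lemma self_in_left_principal_ideal: "x \<in> left_principal_ideal x"
  unfolding left_principal_ideal_def by (rule range_eqI[of _ _ 1]) simp

lemma left_ideal_left_principal_ideal: "left_ideal (left_principal_ideal x)"
proof -
  have "0 \<in> left_principal_ideal x"
    unfolding left_principal_ideal_def by (rule range_eqI[of _ _ 0]) simp
  moreover have "a * x - b * x \<in> left_principal_ideal x" for a b
    unfolding left_principal_ideal_def by (rule range_eqI[of _ _ "a - b"]) (simp add: algebra_simps)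
  moreover have "r * (a * x) \<in> left_principal_ideal x" for r a
    unfolding left_principal_ideal_def by (rule range_eqI[of _ _ "r * a"]) (simp add: mult.assoc)
  ultimately show ?thesis
    unfolding left_ideal_def additive_subgroup_def by (auto simp: left_principal_ideal_def)
qed

text \<open>The image of 1 under the module isomorphism works: if \<open>\<phi> 1\<close> were
  trivial on \<open>Rx\<close>, left linearity would give \<open>\<phi> x = \<phi> 0\<close>,
  against injectivity.\<close>

lemma frobenius_ring_generating_character:
  assumes "frobenius_ring TYPE('a::{ring_1,finite})"
  obtains \<psi> :: "'a::{ring_1,finite} \<Rightarrow> complex" where "\<psi> \<in> add_characters"
    and "\<And>x. x \<noteq> 0 \<Longrightarrow> \<exists>r. \<psi> (r * x) \<noteq> 1"
proof -
  obtain \<phi> :: "'a \<Rightarrow> 'a \<Rightarrow> complex" where bij: "bij_betw \<phi> UNIV add_characters"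
    and act: "\<And>r a. \<phi> (r * a) = char_act r (\<phi> a)"
    using assms unfolding frobenius_ring_def by blast
  have char: "\<phi> a \<in> add_characters" for a using bij by (auto simp: bij_betw_def)
  have act1: "\<phi> x r = \<phi> 1 (r * x)" for x r
    using act[of x 1] by (simp add: char_act_def)
  have at_0: "\<phi> 1 0 = 1"
  proof -
    have "\<phi> 1 (0 + 0) = \<phi> 1 0 * \<phi> 1 0" "\<phi> 1 0 \<noteq> 0"
      using char[of 1] unfolding add_characters_def by blast+
    then show ?thesis by simp
  qed
  have "\<exists>r. \<phi> 1 (r * x) \<noteq> 1" if "x \<noteq> 0" for x
  proof (rule ccontr)
    assume "\<not> ?thesis"
    then have "\<phi> x = \<phi> 0" by (intro ext) (metis act1 at_0 mult_zero_right)
    then show False using bij \<open>x \<noteq> 0\<close> by (auto simp: bij_betw_def inj_def)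
  qed
  then show thesis using that char by blast
qed

text \<open>Removing from \<open>D\<close> the generators of a maximal principal left ideal \<open>Rx\<close> leaves a union
  of principal left ideals, and so does removing them from \<open>Rx\<close>.\<close>

lemma sum_union_principal_eq_0:
  fixes h :: "'a::{ring_1,finite} \<Rightarrow> real"
  assumes princ: "\<And>x. sum h (left_principal_ideal x) = 0"
    and "\<And>r x. x \<in> D \<Longrightarrow> r * x \<in> D"
  shows "sum h D = 0"
  using assms(2)
proof (induction "card D" arbitrary: D rule: less_induct)
  case less
  show ?case
  proof (cases "D = {}")
    case False
    let ?f = "\<lambda>x. card (left_principal_ideal x)"
    have "Max (?f ` D) \<in> ?f ` D" using False by (intro Max_in) auto
    then obtain x where x: "x \<in> D" "?f x = Max (?f ` D)" by force
    have x_max: "?f y \<le> ?f x" if "y \<in> D" for y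
      unfolding x(2) using that by (intro Max_ge) auto
    define G where "G = {y. left_principal_ideal y = left_principal_ideal x}"
    let ?R = "left_principal_ideal x"
    have R_sub: "?R \<subseteq> D" using x(1) less.prems by (auto simp: left_principal_ideal_def)
    have G_sub: "G \<subseteq> ?R" using self_in_left_principal_ideal by (auto simp: G_def)
    have x_G: "x \<in> G" by (simp add: G_def)
    \<comment> \<open>If \<open>r * y\<close> generated \<open>?R\<close>, then \<open>?R\<close>
      would lie in the principal ideal of \<open>y\<close>; as \<open>card ?R\<close> is maximal,
      the two would be equal and \<open>y\<close> would lie in \<open>G\<close>.\<close>
    have mult_notin_G: "r * y \<notin> G" if y: "y \<in> D - G" for r y
    proof
      assume "r * y \<in> G"
      then have "?R = left_principal_ideal (r * y)" by (simp add: G_def)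
      also have "\<dots> \<subseteq> left_principal_ideal y"
        by (auto simp: left_principal_ideal_def simp flip: mult.assoc)
      finally have "?R = left_principal_ideal y"
        using x_max[of y] y by (intro card_seteq) auto
      then show False using y by (simp add: G_def)
    qed
    have sum_G: "sum h D = sum h (D - G) + sum h G"
      using G_sub R_sub by (intro sum.subset_diff) auto
    have "sum h (D - G) = 0"
    proof (rule less.hyps)
      show "card (D - G) < card D" using x(1) x_G by (intro psubset_card_mono) auto
    qed (use mult_notin_G less.prems in auto)
    \<comment> \<open>The sum over \<open>G\<close> is the difference of the sums over
      \<open>?R\<close> and \<open>?R - G\<close>, both zero. If \<open>?R = D\<close>, then
      \<open>princ\<close> at \<open>x\<close> is already the goal.\<close>
    moreover have "sum h G = 0" if "?R \<noteq> D"
    proof -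
      have "sum h (?R - G) = 0"
      proof (rule less.hyps)
        show "card (?R - G) < card D" using R_sub that by (intro psubset_card_mono) auto
        show "r * y \<in> ?R - G" if "y \<in> ?R - G" for r y
          using that mult_notin_G R_sub left_ideal_left_principal_ideal[of x]
          unfolding left_ideal_def by blast
      qed
      then show ?thesis using sum.subset_diff[OF G_sub, of h] princ[of x] by simp
    qed
    ultimately show ?thesis using sum_G princ[of x] by fastforce
  qed simp
qed

section \<open>Averages of homogeneous weights\<close>

lemma homogeneous_weight_zero: "homogeneous_weight w \<gamma> \<Longrightarrow> w 0 = 0"
  unfolding homogeneous_weight_def by blast

text \<open>Needed because the projection of a code to a coordinate is a left ideal that may fail to
  be principal.\<close>

lemma sum_homogeneous_weight_left_ideal:
  fixes w :: "'a::{ring_1,finite} \<Rightarrow> real"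
  assumes frob: "frobenius_ring TYPE('a)" and hom: "homogeneous_weight w \<gamma>"
    and I: "left_ideal I" and nz: "I \<noteq> {0}"
  shows "sum w I = \<gamma> * real (card I)"
proof -
  obtain \<psi> :: "'a \<Rightarrow> complex" where \<psi>: "\<psi> \<in> add_characters"
    and gen: "\<And>x. x \<noteq> 0 \<Longrightarrow> \<exists>r. \<psi> (r * x) \<noteq> 1"
    by (rule frobenius_ring_generating_character[OF frob]) simp
  have sum_Re: "(\<Sum>y\<in>J. Re (\<psi> y)) = 0" if J: "left_ideal J" and x: "x \<in> J" "x \<noteq> 0" for J x
  proof -
    obtain r where r: "\<psi> (r * x) \<noteq> 1" using gen[OF x(2)] by blast
    moreover have "r * x \<in> J" using J x unfolding left_ideal_def by blast
    ultimately have "sum \<psi> J = 0"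
      using sum_character_eq_0 \<psi> J unfolding left_ideal_def by blast
    then show ?thesis by (simp flip: Re_sum)
  qed
  have \<psi>0: "\<psi> 0 = 1"
  proof -
    have "\<psi> (0 + 0) = \<psi> 0 * \<psi> 0" "\<psi> 0 \<noteq> 0"
      using \<psi> unfolding add_characters_def by blast+
    then show ?thesis by simp
  qed
  \<comment> \<open>The character term sums to 0 over nonzero left ideals and makes
    \<open>h 0 = 0\<close>, whereas \<open>\<gamma> - w\<close> alone would give
    \<open>\<gamma>\<close> on the zero ideal.\<close>
  define h where "h = (\<lambda>x. \<gamma> - w x - \<gamma> * Re (\<psi> x))"
  have sum_h: "sum h J = \<gamma> * real (card J) - sum w J" if "left_ideal J" "x \<in> J" "x \<noteq> 0" for J x
    using sum_Re[OF that] by (simp add: h_def sum_subtractf flip: sum_distrib_left)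
  have "sum h (left_principal_ideal x) = 0" for x
  proof (cases "x = 0")
    case True
    then have "left_principal_ideal x = {0}" by (auto simp: left_principal_ideal_def)
    then show ?thesis using homogeneous_weight_zero[OF hom] \<psi>0 by (simp add: h_def)
  next
    case False
    then have "sum w (left_principal_ideal x) = \<gamma> * real (card (left_principal_ideal x))"
      using hom unfolding homogeneous_weight_def by blast
    then show ?thesis
      using sum_h[OF left_ideal_left_principal_ideal self_in_left_principal_ideal False] by simp
  qed
  then have "sum h I = 0"
    by (rule sum_union_principal_eq_0) (use I in \<open>unfold left_ideal_def, blast\<close>)
  moreover obtain x where "x \<in> I" "x \<noteq> 0"
    using nz I additive_subgroup_zero unfolding left_ideal_def by blast
  ultimately show ?thesis using sum_h[OF I] by simp
qed

section \<open>Linear codes and their total weight\<close>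

lemma left_linear_code_additive_subgroup:
  assumes "left_linear_code C"
  shows "additive_subgroup C"
proof -
  have "x - y \<in> C" if "x \<in> C" "y \<in> C" for x y
  proof -
    have "x + (-1) *s y \<in> C" using assms that unfolding left_linear_code_def by blast
    moreover have "x + (-1) *s y = x - y" by (simp add: vec_eq_iff)
    ultimately show ?thesis by simp
  qed
  then show ?thesis using assms by (simp add: additive_subgroup_def left_linear_code_def)
qed

lemma left_linear_code_coordinate_ideal:
  fixes C :: "('a::ring_1 ^ 'n::finite) set"
  assumes C: "left_linear_code C"
  shows "left_ideal ((\<lambda>c. c $ i) ` C)"
proof -
  have sub: "additive_subgroup C" using C by (rule left_linear_code_additive_subgroup)
  have "0 \<in> (\<lambda>c. c $ i) ` C"
    using additive_subgroup_zero[OF sub] by (intro image_eqI[of _ _ 0]) auto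
  moreover have "x $ i - y $ i \<in> (\<lambda>c. c $ i) ` C" if "x \<in> C" "y \<in> C" for x y
    using additive_subgroup_diff[OF sub that] by (intro image_eqI[of _ _ "x - y"]) auto
  moreover have "r * x $ i \<in> (\<lambda>c. c $ i) ` C" if "x \<in> C" for r x
    using C that by (intro image_eqI[of _ _ "r *s x"]) (auto simp: left_linear_code_def)
  ultimately show ?thesis unfolding left_ideal_def additive_subgroup_def by auto
qed

lemma left_linear_code_cyclic_submodule:
  "left_linear_code (cyclic_submodule (c :: 'a::ring_1 ^ 'n::finite))"
proof -
  have "0 \<in> cyclic_submodule c"
    unfolding cyclic_submodule_def by (rule range_eqI[of _ _ 0]) (simp add: vec_eq_iff)
  moreover have "a *s c + b *s c \<in> cyclic_submodule c" for a b
    unfolding cyclic_submodule_def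
    by (rule range_eqI[of _ _ "a + b"]) (simp add: vec_eq_iff algebra_simps)
  moreover have "r *s (a *s c) \<in> cyclic_submodule c" for r a
    unfolding cyclic_submodule_def
    by (rule range_eqI[of _ _ "r * a"]) (simp add: vec_eq_iff algebra_simps)
  ultimately show ?thesis unfolding left_linear_code_def by (auto simp: cyclic_submodule_def)
qed

text \<open>A coordinate contributes \<open>\<gamma>\<close> per word on average if its projection
  is nonzero, and 0 otherwise. Coordinate \<open>i\<close> contributes nothing, hence the factor n -
  1.\<close>

lemma sum_vec_weight_le:
  fixes w :: "'a::{ring_1,finite} \<Rightarrow> real" and C :: "('a ^ 'n::finite) set"
  assumes frob: "frobenius_ring TYPE('a)" and hom: "homogeneous_weight w \<gamma>" and "\<gamma> > 0"
    and C: "left_linear_code C" and i: "\<And>c. c \<in> C \<Longrightarrow> c $ i = 0"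
  shows "(\<Sum>c\<in>C. vec_weight w c) \<le> \<gamma> * real (card C) * (real CARD('n) - 1)"
proof -
  have sub: "additive_subgroup C" using C by (rule left_linear_code_additive_subgroup)
  have le: "(\<Sum>c\<in>C. w (c $ j)) \<le> \<gamma> * real (card C)" for j
  proof -
    let ?I = "(\<lambda>c. c $ j) ` C"
    let ?K = "{c \<in> C. c $ j = 0}"
    have "(\<Sum>c\<in>C. w (c $ j)) = real (card ?K) * sum w ?I"
      by (rule sum_over_additive_image[OF sub]) auto
    moreover have "card C = card ?K * card ?I"
      by (rule card_additive_image[OF sub]) auto
    moreover have "sum w ?I \<le> \<gamma> * real (card ?I)"
    proof (cases "?I = {0}")
      case True
      then show ?thesis using homogeneous_weight_zero[OF hom] \<open>\<gamma> > 0\<close> by (simp add: True)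
    next
      case False
      then show ?thesis
        using sum_homogeneous_weight_left_ideal[OF frob hom left_linear_code_coordinate_ideal[OF C]]
        by simp
    qed
    moreover have "real (card ?K) * sum w ?I \<le> real (card ?K) * (\<gamma> * real (card ?I))"
      using calculation(3) by (intro mult_left_mono) auto
    ultimately show ?thesis by (simp add: mult.left_commute)
  qed
  have "(\<Sum>c\<in>C. vec_weight w c) = (\<Sum>j\<in>UNIV. \<Sum>c\<in>C. w (c $ j))"
    unfolding vec_weight_def by (rule sum.swap)
  also have "\<dots> = (\<Sum>c\<in>C. w (c $ i)) + (\<Sum>j\<in>UNIV - {i}. \<Sum>c\<in>C. w (c $ j))"
    by (rule sum.remove) auto
  also have "(\<Sum>c\<in>C. w (c $ i)) = 0"
    using i homogeneous_weight_zero[OF hom] by simp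
  also have "(\<Sum>j\<in>UNIV - {i}. \<Sum>c\<in>C. w (c $ j)) \<le> (\<Sum>j\<in>UNIV - {i}. \<gamma> * real (card C))"
    by (intro sum_mono le)
  also have "(\<Sum>j\<in>UNIV - {i}. \<gamma> * real (card C)) = \<gamma> * real (card C) * (real CARD('n) - 1)"
    by (simp add: card_Diff_singleton of_nat_diff Suc_leI)
  finally show ?thesis by simp
qed

text \<open>Each nonzero word of \<open>D\<close> is a nonzero word of \<open>C\<close>; the zero
  word has weight 0 and accounts for the -1.\<close>

lemma sum_vec_weight_ge:
  fixes w :: "'a::{ring_1,finite} \<Rightarrow> real" and D :: "('a ^ 'n::finite) set"
  assumes "w 0 = 0" and "0 \<in> D" and "D \<subseteq> C"
  shows "(real (card D) - 1) * min_vec_weight w C \<le> (\<Sum>c\<in>D. vec_weight w c)"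
proof -
  have "(\<Sum>c\<in>D - {0}. min_vec_weight w C) \<le> (\<Sum>c\<in>D - {0}. vec_weight w c)"
    unfolding min_vec_weight_def using \<open>D \<subseteq> C\<close> by (intro sum_mono Min_le) auto
  moreover have "(\<Sum>c\<in>D. vec_weight w c) = vec_weight w (0 :: 'a ^ 'n) +
      (\<Sum>c\<in>D - {0}. vec_weight w c)"
    by (rule sum.remove) (use \<open>0 \<in> D\<close> in auto)
  moreover have "card D \<ge> 1"
    using \<open>0 \<in> D\<close> by (metis One_nat_def Suc_leI card_gt_0_iff empty_iff finite)
  ultimately show ?thesis
    using assms by (simp add: vec_weight_def card_Diff_singleton of_nat_diff)
qed

section \<open>Numerical estimates\<close>

lemma mult_le_power_self:
  fixes k P :: nat
  assumes "P \<ge> 2" and "k \<ge> 1"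
  shows "k * P \<le> P ^ k"
  using \<open>k \<ge> 1\<close>
proof (induction k rule: dec_induct)
  case (step k)
  have "Suc k * P \<le> (k * P) * 2" using step by simp
  also have "\<dots> \<le> P ^ k * P" using step.IH \<open>P \<ge> 2\<close> by (rule mult_le_mono)
  finally show ?case by (simp add: mult.commute)
qed simp

text \<open>Here \<open>\<delta>\<close> stands for d / \<gamma> and \<open>k * P\<close> for the
  size of the subcode. Replacing \<open>\<delta>\<close> by the smaller \<open>n\<close> in
  \<open>le\<close> first bounds that size by \<open>n\<close>.\<close>

lemma plotkin_estimate:
  fixes n k P \<delta> :: real
  assumes P: "P \<ge> 2" and k: "k \<ge> 1" and n: "n \<le> \<delta>" "n \<ge> 1"
    and le: "(k * P - 1) * \<delta> \<le> k * P * (n - 1)"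
  shows "(P - 1) / P * \<delta> \<le> n - k"
proof -
  have kP: "k * P > 1" using P k mult_mono[of 1 k 2 P] by simp
  have "(k * P - 1) * n \<le> k * P * (n - 1)"
    using le n kP mult_left_mono[of n \<delta> "k * P - 1"] by linarith
  then have "k * P \<le> n" by (simp add: algebra_simps)
  then have "(k - 1) * (n - k * P) \<ge> 0" using k by simp
  \<comment> \<open>The right side minus the left side is exactly
    \<open>(k - 1) * (n - k * P)\<close>.\<close>
  then have *: "(P - 1) * (k * (n - 1)) \<le> (k * P - 1) * (n - k)"
    by (simp add: algebra_simps)
  have "(k * P - 1) * ((P - 1) * \<delta>) \<le> (P - 1) * (k * P * (n - 1))"
    using mult_left_mono[OF le, of "P - 1"] P by (simp add: mult.left_commute)
  also have "\<dots> = P * ((P - 1) * (k * (n - 1)))" by (simp add: mult_ac)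
  also have "\<dots> \<le> P * ((k * P - 1) * (n - k))" using * P by (intro mult_left_mono) auto
  also have "\<dots> = (k * P - 1) * (P * (n - k))" by (simp add: mult_ac)
  finally have "(P - 1) * \<delta> \<le> P * (n - k)" using kP by simp
  then show ?thesis using P by (simp add: field_simps)
qed

theorem theorem2:
  fixes w :: "'a::{ring_1,finite} \<Rightarrow> real"
    and \<gamma> d :: real
    and C :: "('a ^ 'n::finite) set"
    and n P :: nat
  assumes "frobenius_ring TYPE('a)"
    and "homogeneous_weight w \<gamma>"
    and "\<gamma> > 0"
    and "n = CARD('n)"
    and "left_linear_code C"
    and "C \<noteq> {0}"
    and "d = min_vec_weight w C"
    and "\<gamma> * real n \<le> d"
    and "min_hamming_weight C < n"
    and "P = Max {card (cyclic_submodule c) | c. c \<in> C \<and> hamming_weight c < n}"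
  shows "int n - \<lceil>(real P - 1) / real P * (d / \<gamma>)\<rceil>
           \<ge> \<lceil>log (real P) (real (card C)) - log (real P) (real CARD('a))\<rceil>"
proof -
  let ?S = "{card (cyclic_submodule c) | c. c \<in> C \<and> hamming_weight c < n}"
  have sub: "additive_subgroup C" using assms(5) by (rule left_linear_code_additive_subgroup)
  have zero: "0 \<in> C" using sub by (rule additive_subgroup_zero)
  have S: "?S = (\<lambda>c. card (cyclic_submodule c)) ` {c \<in> C. hamming_weight c < n}" by blast
  then have S_fin: "finite ?S" by simp
  have "C - {0} \<noteq> {}" using assms(6) zero by blast
  then have "min_hamming_weight C \<in> hamming_weight ` (C - {0})"
    unfolding min_hamming_weight_def by (intro Min_in) auto
  then obtain b where "b \<in> C - {0}" "min_hamming_weight C = hamming_weight b" by blast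
  then have b: "b \<in> C" "b \<noteq> 0" "hamming_weight b < n" using assms(9) by auto
  \<comment> \<open>The word \<open>b\<close> has a zero coordinate, so it competes for the maximum,
    and its cyclic submodule contains both 0 and \<open>b\<close>. Hence the base of the logarithm
    exceeds 1.\<close>
  have "2 \<le> P"
  proof -
    have "{0, b} \<subseteq> cyclic_submodule b"
      unfolding cyclic_submodule_def
      by (auto simp: vec_eq_iff intro: range_eqI[of _ _ 0] range_eqI[of _ _ 1])
    then have "card {0, b} \<le> card (cyclic_submodule b)" by (intro card_mono) auto
    also have "\<dots> \<le> P" unfolding assms(10) by (rule Max_ge[OF S_fin]) (use b in blast)
    finally show ?thesis using b(2) by simp
  qed
  have "P \<in> ?S" unfolding assms(10) by (rule Max_in[OF S_fin]) (use b in blast)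
  then obtain c where c: "c \<in> C" "hamming_weight c < n" "P = card (cyclic_submodule c)" by blast
  obtain i where i: "c $ i = 0"
  proof (rule ccontr)
    assume "\<not> thesis"
    then have "{i. c $ i \<noteq> 0} = UNIV" using that by blast
    then show False using c(2) assms(4) by (simp add: hamming_weight_def)
  qed
  define D where "D = {x \<in> C. x $ i = 0}"
  have D: "left_linear_code D" using assms(5) by (auto simp: D_def left_linear_code_def)
  have "D \<subseteq> C" by (simp add: D_def)
  have D0: "0 \<in> D" using zero by (simp add: D_def)
  \<comment> \<open>All multiples of \<open>c\<close> vanish at \<open>i\<close> as \<open>c\<close>
    does, so Lagrange's theorem applies inside \<open>D\<close>.\<close>
  have "cyclic_submodule c \<subseteq> D"
    using c(1) i assms(5) by (auto simp: D_def cyclic_submodule_def left_linear_code_def)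
  then have "P dvd card D"
    unfolding c(3)
    by (intro additive_subgroup_card_dvd left_linear_code_additive_subgroup D
        left_linear_code_cyclic_submodule) auto
  then obtain k where k: "card D = k * P" by (metis dvd_def mult.commute)
  have "card D > 0" using D0 by (auto simp: card_gt_0_iff)
  then have "k \<ge> 1" using k by (cases k) auto
  have "(real (card D) - 1) * d \<le> (\<Sum>x\<in>D. vec_weight w x)"
    unfolding assms(7)
    by (rule sum_vec_weight_ge) (fact homogeneous_weight_zero[OF assms(2)] D0 \<open>D \<subseteq> C\<close>)+
  also have "\<dots> \<le> \<gamma> * real (card D) * (real n - 1)"
    unfolding assms(4) by (rule sum_vec_weight_le[OF assms(1-3) D, of i]) (simp add: D_def)
  finally have "(real k * real P - 1) * (d / \<gamma>) \<le> real k * real P * (real n - 1)"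
    using assms(3) by (simp add: k field_simps)
  moreover have "real n \<le> d / \<gamma>" using assms(3,8) by (simp add: field_simps)
  moreover have "real n \<ge> 1" using assms(4) by (simp add: Suc_leI)
  ultimately have "(real P - 1) / real P * (d / \<gamma>) \<le> real n - real k"
    using \<open>2 \<le> P\<close> \<open>k \<ge> 1\<close> by (intro plotkin_estimate) auto
  \<comment> \<open>As n - k is an integer, the bound survives rounding up.\<close>
  then have upper: "\<lceil>(real P - 1) / real P * (d / \<gamma>)\<rceil> \<le> int n - int k"
    by (simp add: ceiling_le_iff)
  \<comment> \<open>\<open>D\<close> is the kernel of the projection to coordinate \<open>i\<close>,
    whose image has at most \<open>CARD('a)\<close> elements.\<close>
  have "card C = card D * card ((\<lambda>x. x $ i) ` C)"
    unfolding D_def by (rule card_additive_image[OF sub]) auto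
  also have "\<dots> \<le> P ^ k * CARD('a)"
    using mult_le_power_self[OF \<open>2 \<le> P\<close> \<open>k \<ge> 1\<close>]
    by (intro mult_le_mono) (auto simp: k intro: card_mono)
  finally have "real (card C) \<le> real P ^ k * real CARD('a)"
    by (metis of_nat_le_iff of_nat_mult of_nat_power)
  moreover have "card C > 0" using zero by (auto simp: card_gt_0_iff)
  ultimately have "log (real P) (real (card C)) \<le> log (real P) (real P ^ k * real CARD('a))"
    using \<open>2 \<le> P\<close> by simp
  also have "\<dots> = real k + log (real P) (real CARD('a))"
    using \<open>2 \<le> P\<close> by (simp add: log_mult log_nat_power)
  finally have "\<lceil>log (real P) (real (card C)) - log (real P) (real CARD('a))\<rceil> \<le> int k"
    by (simp add: ceiling_le_iff)
  \<comment> \<open>The integer \<open>k\<close> separates the two sides.\<close>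
  then show ?thesis using upper by linarith
qed

end
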